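(* Let $q$ be a prime power and let $A$ be a $3\times 3$ matrix with entries in $\mathbb{F}_q$. Let $C_A$ be the curve in $\mathbb{P}^2$ defined by $F_A = 0$, where \[ F_A = (x,y,z)\,A\,{}^t\bigl(y^q z - y z^q,\; z^q x - z x^q,\; x^q y - x y^q\bigr). \] Then $C_A$ is nonsingular if and only if the characteristic polynomial $f_A(t) = \det(tE - A)$ of $A$ is irreducible over $\mathbb{F}_q$.
   Context: $K$ is the algebraic closure of $\mathbb{F}_q$, $x,y,z$ are homogeneous coordinates of $\mathbb{P}^2$ over $\mathbb{F}_q$, and $E$ is the $3\times 3$ identity matrix. ${}^t(\cdot)$ denotes transpose. The curve defined by $F=0$ (with $F$ homogeneous over $\mathbb{F}_q$) is nonsingular if it is nonsingular at every $K$-point, not only at the $\mathbb{F}_q$-points: there is no point of $\mathbb{P}^2(K)$ at which $F$, $F_x$, $F_y$, $F_z$ all vanish. (In particular, if $F_A$ is the zero polynomial, $C_A$ is not nonsingular.) *)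

theory Defs
  imports
    "HOL-Analysis.Determinants"
    "HOL-Library.Poly_Mapping"
    "HOL-Computational_Algebra.Computational_Algebra"
    "HOL-Algebra.Algebraic_Closure_Type"
begin

text \<open>
  Polynomials in three variables over \<open>'a\<close>, as finitely supported functions from exponent
  vectors to coefficients; multiplication is the convolution product of \<^theory>\<open>HOL-Library.Poly_Mapping\<close>.
  In the numeral type \<open>3\<close> the indices are \<open>1\<close>, \<open>2\<close> and \<open>3 = 0\<close>; the coordinates
  \<open>x\<close>, \<open>y\<close>, \<open>z\<close> have indices \<open>1\<close>, \<open>2\<close>, \<open>3\<close>.
\<close>
type_synonym 'a poly3 = "(3 \<Rightarrow>\<^sub>0 nat) \<Rightarrow>\<^sub>0 'a"

definition Const3 :: "'a \<Rightarrow> 'a :: comm_ring_1 poly3" where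
  "Const3 c = Poly_Mapping.single 0 c"

definition Var3 :: "3 \<Rightarrow> 'a :: comm_ring_1 poly3" where
  "Var3 i = Poly_Mapping.single (Poly_Mapping.single i 1) 1"

definition pderiv3 :: "3 \<Rightarrow> 'a :: comm_ring_1 poly3 \<Rightarrow> 'a poly3" where
  "pderiv3 i F = (\<Sum>m\<in>Poly_Mapping.keys F.
     Poly_Mapping.single (m - Poly_Mapping.single i 1)
       (of_nat (Poly_Mapping.lookup m i) * Poly_Mapping.lookup F m))"

definition eval3_ac :: "'a :: field poly3 \<Rightarrow> 'a alg_closure ^ 3 \<Rightarrow> 'a alg_closure" where
  "eval3_ac F P = (\<Sum>m\<in>Poly_Mapping.keys F.
     to_ac (Poly_Mapping.lookup F m) * (\<Prod>i\<in>UNIV. (P $ i) ^ Poly_Mapping.lookup m i))"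

text \<open>
  The predicate is meant for homogeneous \<open>F\<close>. Points of the projective plane over the algebraic
  closure are given by their nonzero coordinate vectors; for homogeneous \<open>F\<close> the vanishing of \<open>F\<close>
  and of its partial derivatives does not depend on the choice of the vector.
\<close>
definition nonsingular_curve :: "'a :: field poly3 \<Rightarrow> bool" where
  "nonsingular_curve F \<longleftrightarrow>
     \<not> (\<exists>P :: 'a alg_closure ^ 3. P \<noteq> 0 \<and> eval3_ac F P = 0 \<and>
          eval3_ac (pderiv3 1 F) P = 0 \<and> eval3_ac (pderiv3 2 F) P = 0 \<and>
          eval3_ac (pderiv3 3 F) P = 0)"

definition curve_form :: "nat \<Rightarrow> 'a :: field ^ 3 ^ 3 \<Rightarrow> 'a poly3" where
  "curve_form q A = (let x = Var3 1; y = Var3 2; z = Var3 3 in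
     scalar_product (vector [x, y, z])
       (map_matrix Const3 A *v
          vector [y ^ q * z - y * z ^ q, z ^ q * x - z * x ^ q, x ^ q * y - x * y ^ q]))"

definition charpoly :: "'a :: comm_ring_1 ^ 'n ^ 'n \<Rightarrow> 'a poly" where
  "charpoly A = det (mat [:0, 1:] - map_matrix (\<lambda>a. [:a:]) A)"

end

theory Submission
  imports Defs
begin

text \<open>
  Write \<open>P\<^sup>q\<close> for the vector obtained from \<open>P\<close> by raising each coordinate to the power \<open>q\<close>, and
  put \<open>w = P\<^sup>q \<times> P\<close>. The value of the form at \<open>P\<close> is the scalar product \<open>P \<cdot> (A w)\<close>. As \<open>q = 0\<close> in
  the field, \<open>P\<^sup>q\<close> is constant for differentiation, and the gradient at \<open>P\<close> is
  \<open>A w + (P A) \<times> P\<^sup>q\<close>, where \<open>P A\<close> is the row vector \<open>P\<close> times \<open>A\<close>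
  (lemmas \<open>eval3_ac_curve_form\<close> and \<open>eval3_ac_pderiv3_curve_form\<close>).

  If the characteristic polynomial is reducible, then, being a cubic, it has a root in the finite
  field, so \<open>A\<close> has a left eigenvector \<open>P\<close> with coordinates in that field. There \<open>P\<^sup>q = P\<close>, so
  \<open>w = 0\<close> and \<open>P A\<close> is parallel to \<open>P\<^sup>q\<close>: the point \<open>P\<close> is singular.

  Conversely, every singular point produces an eigenvalue \<open>a\<close> of \<open>A\<close> with
  \<open>a\<^bsup>q\<^sup>2\<^esup> = a\<close> (\<open>singular_imp_eigenvalue\<close>). Such an \<open>a\<close> is a root of
  \<open>(X - a) (X - a\<^sup>q)\<close>, whose coefficients are fixed by the Frobenius map and therefore lie in the
  finite field; an irreducible polynomial with the root \<open>a\<close> has degree at most \<open>2\<close>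
  (\<open>irreducible_degree_le_2\<close>), so the characteristic polynomial, a cubic, is reducible.

  If \<open>w = 0\<close>, then \<open>P\<^sup>q\<close> is a multiple of \<open>P\<close>, the gradient condition makes \<open>P\<close> a left eigenvector,
  and applying the Frobenius map to \<open>P A = a P\<close> gives \<open>a\<^sup>q = a\<close>.
  The eigenvalue is found as follows when \<open>P\<close> and \<open>P\<^sup>q\<close> are independent, that is, \<open>w \<noteq> 0\<close>.
  The vanishing of the form puts \<open>P A\<close> into the plane orthogonal to \<open>w\<close>, so \<open>P A = a P + b P\<^sup>q\<close>; the
  gradient condition then reads \<open>A w = a w\<close>. If \<open>w\<^sup>q\<close> is parallel to \<open>w\<close>, comparing eigenvalues
  gives \<open>a\<^sup>q = a\<close>. Otherwise \<open>P\<close>, \<open>P\<^sup>q\<close> and its next Frobenius image \<open>P''\<close> are independent, so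
  \<open>P'' \<cdot> w \<noteq> 0\<close>. For every \<open>v\<close> the product \<open>(v A) \<cdot> w = v \<cdot> (A w)\<close> equals \<open>a (v \<cdot> w)\<close>;
  applied to \<open>v = P\<^sup>q\<close> this forces \<open>b = 0\<close>, so that \<open>P''\<close> is a left eigenvector for
  \<open>a\<^bsup>q\<^sup>2\<^esup>\<close>, and applied to \<open>v = P''\<close> it gives \<open>a\<^bsup>q\<^sup>2\<^esup> = a\<close>.
\<close>

section \<open>Evaluation and differentiation of polynomials in three variables\<close>

lemma poly_mapping_single_induct [case_names single add]:
  fixes F :: "'b \<Rightarrow>\<^sub>0 'c :: comm_monoid_add"
  assumes single: "\<And>m c. Q (Poly_Mapping.single m c)"
    and add: "\<And>F G. Q F \<Longrightarrow> Q G \<Longrightarrow> Q (F + G)"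
  shows "Q F"
proof (induction F rule: update_induct)
  case const
  show ?case using single[of undefined 0] by simp
next
  case (update F m c)
  have "Poly_Mapping.update m c F = F + Poly_Mapping.single m c"
    using update(1)
    by (intro poly_mapping_eqI)
       (auto simp: lookup_update lookup_add lookup_single in_keys_iff when_def)
  then show ?case using add[OF update(3) single] by simp
qed

lemma eval3_ac_single:
  "eval3_ac (Poly_Mapping.single m c) P = to_ac c * (\<Prod>i\<in>UNIV. (P $ i) ^ Poly_Mapping.lookup m i)"
  by (cases "c = 0") (simp_all add: eval3_ac_def)

lemma eval3_ac_add: "eval3_ac (F + G) P = eval3_ac F P + eval3_ac G P"
  unfolding eval3_ac_def by (rule setsum_keys_plus_distrib) (simp_all add: algebra_simps)

lemma eval3_ac_mult: "eval3_ac (F * G) P = eval3_ac F P * eval3_ac G P"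
proof (induction F rule: poly_mapping_single_induct)
  case (single m c)
  show ?case
  proof (induction G rule: poly_mapping_single_induct)
    case (single n d)
    show ?case
      by (simp add: mult_single eval3_ac_single lookup_add power_add prod.distrib)
  qed (simp add: distrib_left eval3_ac_add)
qed (simp add: distrib_right eval3_ac_add)

lemma eval3_ac_Const3: "eval3_ac (Const3 c) P = to_ac c"
  by (simp add: Const3_def eval3_ac_single)

lemma eval3_ac_0: "eval3_ac 0 P = 0"
  by (simp add: eval3_ac_def)

lemma eval3_ac_1: "eval3_ac 1 P = 1"
  using eval3_ac_Const3[of 1 P] by (simp add: Const3_def)

lemma eval3_ac_Var3: "eval3_ac (Var3 i) P = P $ i"
proof -
  have "(\<Prod>j\<in>UNIV. (P $ j) ^ Poly_Mapping.lookup (Poly_Mapping.single i 1) j)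
      = (\<Prod>j\<in>UNIV. if j = i then P $ j else 1)"
    by (intro prod.cong) (auto simp: lookup_single when_def)
  then show ?thesis by (simp add: Var3_def eval3_ac_single)
qed

lemma eval3_ac_diff: "eval3_ac (F - G) P = eval3_ac F P - eval3_ac G P"
  using eval3_ac_add[of "F - G" G P] by simp

lemma eval3_ac_power: "eval3_ac (F ^ n) P = eval3_ac F P ^ n"
  by (induction n) (simp_all add: eval3_ac_1 eval3_ac_mult)

lemmas eval3_ac_simps =
  eval3_ac_0 eval3_ac_1 eval3_ac_add eval3_ac_diff eval3_ac_mult eval3_ac_power
  eval3_ac_Const3 eval3_ac_Var3

lemma pderiv3_single:
  "pderiv3 i (Poly_Mapping.single m c) =
     Poly_Mapping.single (m - Poly_Mapping.single i 1) (of_nat (Poly_Mapping.lookup m i) * c)"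
  by (cases "c = 0") (simp_all add: pderiv3_def)

lemma pderiv3_add: "pderiv3 i (F + G) = pderiv3 i F + pderiv3 i G"
  unfolding pderiv3_def
  by (rule setsum_keys_plus_distrib) (simp_all add: algebra_simps single_add)

text \<open>
  Both sides are additive in each factor, so the Leibniz rule only has to be checked on terms.
\<close>
lemma pderiv3_mult: "pderiv3 i (F * G) = pderiv3 i F * G + F * pderiv3 i G"
proof (induction F rule: poly_mapping_single_induct)
  case (single m c)
  show ?case
  proof (induction G rule: poly_mapping_single_induct)
    case (single n d)
    let ?e = "Poly_Mapping.single i (1 :: nat)"
    \<comment> \<open>Exponents are subtracted with truncation at \<open>0\<close>. Lowering the \<open>i\<close>-th exponent before or after
      multiplication by another term differs only if that exponent is \<open>0\<close>, and then the
      coefficient vanishes.\<close>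
    have lower: "Poly_Mapping.single (k - ?e + l) (of_nat (Poly_Mapping.lookup k i) * b) =
        Poly_Mapping.single (k + l - ?e) (of_nat (Poly_Mapping.lookup k i) * b)"
      for k l and b :: 'a
    proof (cases "Poly_Mapping.lookup k i = 0")
      case False
      then have "k - ?e + l = k + l - ?e"
        by (intro poly_mapping_eqI) (auto simp: lookup_add lookup_minus lookup_single when_def)
      then show ?thesis by simp
    qed simp
    show ?case
      using lower[of m n "c * d"] lower[of n m "c * d"]
      by (simp add: mult_single pderiv3_single lookup_add algebra_simps single_add)
  qed (simp add: distrib_left pderiv3_add)
qed (simp add: distrib_right pderiv3_add)

lemma pderiv3_Const3: "pderiv3 i (Const3 c) = 0"
  by (simp add: Const3_def pderiv3_single)

lemma pderiv3_Var3: "pderiv3 i (Var3 j) = (if i = j then 1 else 0)"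
  by (auto simp: Var3_def pderiv3_single lookup_single when_def)

lemma pderiv3_diff: "pderiv3 i (F - G) = pderiv3 i F - pderiv3 i G"
  using pderiv3_add[of i "F - G" G] by simp

lemma pderiv3_power: "pderiv3 i (F ^ n) = of_nat n * F ^ (n - 1) * pderiv3 i F"
proof (induction n)
  case 0
  show ?case using pderiv3_Const3[of i 1] by (simp add: Const3_def)
next
  case (Suc n)
  have "pderiv3 i (F ^ Suc n) = pderiv3 i F * F ^ n + F * (of_nat n * F ^ (n - 1) * pderiv3 i F)"
    by (simp only: power_Suc pderiv3_mult Suc)
  then show ?case by (cases n) (simp_all add: algebra_simps)
qed

section \<open>The Frobenius map of the algebraic closure\<close>

text \<open>Translation by \<open>1\<close> permutes the ring, but adds \<open>CARD('a)\<close> to the sum of all elements.\<close>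
lemma of_nat_card_eq_0:
  "of_nat CARD('a :: {ring_1, finite}) = (0 :: 'a)"
proof -
  have "(\<Sum>x\<in>UNIV. x + 1 :: 'a) = (\<Sum>x\<in>UNIV. x)"
    by (rule sum.reindex_bij_witness[of _ "\<lambda>x. x - 1" "\<lambda>x. x + 1"]) auto
  then show ?thesis by (simp add: sum.distrib)
qed

text \<open>Multiplication by \<open>c \<noteq> 0\<close> permutes the nonzero elements, but multiplies their product by
  \<open>c ^ (CARD('a) - 1)\<close>.\<close>
lemma power_card_eq_self:
  fixes c :: "'a :: {field, finite}"
  shows "c ^ CARD('a) = c"
proof (cases "c = 0")
  case False
  have "(\<Prod>x\<in>UNIV - {0}. c * x) = (\<Prod>x\<in>UNIV - {0}. x)"
    by (rule prod.reindex_bij_witness[of _ "\<lambda>x. x / c" "\<lambda>x. c * x"]) (use False in auto)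
  then have "c ^ (CARD('a) - 1) = 1"
    by (simp add: prod.distrib card_Diff_singleton)
  then have "c * c ^ (CARD('a) - 1) = c" by simp
  then show ?thesis
    by (simp flip: power_Suc)
qed simp

lemma card_range_to_ac: "card (range (to_ac :: 'a :: {field, finite} \<Rightarrow> _)) = CARD('a)"
  by (simp add: card_image inj_to_ac)

text \<open>
  With \<open>q = CARD('a)\<close>, the monic polynomials \<open>(X + x)\<^sup>q\<close> and \<open>X\<^sup>q + x\<^sup>q\<close> of degree \<open>q\<close> are equal as
  soon as they agree at the \<open>q\<close> elements of the finite field. This criterion is used twice. If \<open>x\<close>
  lies in the finite field, the two sides agree there because the \<open>q\<close>-th power is the identity;
  by symmetry in the two summands, the resulting identity is the agreement needed for arbitrary \<open>x\<close>.
\<close>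
lemma power_card_add:
  fixes x y :: "'a :: {field, finite} alg_closure"
  shows "(x + y) ^ CARD('a) = x ^ CARD('a) + y ^ CARD('a)"
proof -
  let ?q = "CARD('a)"
  have agree: "(x + y) ^ ?q = x ^ ?q + y ^ ?q"
    if rational: "\<And>c :: 'a. (x + to_ac c) ^ ?q = x ^ ?q + to_ac c ^ ?q" for x y :: "'a alg_closure"
  proof -
    have "[:x, 1:] ^ ?q = monom 1 ?q + [:x ^ ?q:]"
    proof (rule poly_eqI_degree_lead_coeff[where n = ?q and A = "range (to_ac :: 'a \<Rightarrow> _)"])
      show "Polynomial.coeff ([:x, 1:] ^ ?q) ?q = Polynomial.coeff (monom 1 ?q + [:x ^ ?q:]) ?q"
        by (simp add: coeff_linear_power coeff_eq_0)
      show "Polynomial.degree (monom 1 ?q + [:x ^ ?q:]) \<le> ?q"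
        by (intro degree_add_le) (simp_all add: degree_monom_le)
    qed (auto simp: degree_linear_power card_range_to_ac poly_monom rational add.commute)
    then have "poly ([:x, 1:] ^ ?q) y = poly (monom 1 ?q + [:x ^ ?q:]) y" by simp
    then show ?thesis by (simp add: poly_monom add.commute)
  qed
  show ?thesis
  proof (rule agree)
    fix c :: 'a
    have "(to_ac c + x) ^ ?q = to_ac c ^ ?q + x ^ ?q"
      by (rule agree) (simp add: power_card_eq_self flip: to_ac_add to_ac_power)
    then show "(x + to_ac c) ^ ?q = x ^ ?q + to_ac c ^ ?q"
      by (simp add: add.commute)
  qed
qed

text \<open>The polynomial \<open>X\<^sup>q - X\<close> has at most \<open>q\<close> roots, and the finite field already provides \<open>q\<close>.\<close>
lemma power_card_fixed_imp_rational:
  fixes x :: "'a :: {field, finite} alg_closure"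
  assumes "x ^ CARD('a) = x"
  shows "x \<in> range to_ac"
proof -
  let ?f = "monom 1 CARD('a) - [:0, 1:] :: 'a alg_closure poly"
  have card: "CARD('a) > 1"
    using card_mono[of UNIV "{0, 1 :: 'a}"] by simp
  then have coeff: "Polynomial.coeff ?f CARD('a) = 1"
    by (simp add: coeff_pCons split: nat.splits)
  then have nz: "?f \<noteq> 0" by (metis coeff_0 zero_neq_one)
  have "Polynomial.degree ?f \<le> CARD('a)"
    using card by (intro degree_diff_le) (auto simp: degree_monom_le)
  then have "card {x. poly ?f x = 0} \<le> CARD('a)" "finite {x. poly ?f x = 0}"
    using card_poly_roots_bound[OF nz] poly_roots_finite[OF nz] by linarith+
  moreover have "range (to_ac :: 'a \<Rightarrow> _) \<subseteq> {x. poly ?f x = 0}"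
    by (auto simp: poly_monom power_card_eq_self simp flip: to_ac_power)
  ultimately have "range (to_ac :: 'a \<Rightarrow> _) = {x. poly ?f x = 0}"
    by (intro card_seteq) (auto simp: card_range_to_ac)
  then show ?thesis using assms by (auto simp: poly_monom)
qed

section \<open>Roots of irreducible polynomials in the algebraic closure\<close>

lemma map_poly_to_ac_mult:
  "map_poly to_ac (f * g) = map_poly to_ac f * map_poly to_ac g"
  by (rule poly_eqI) (simp add: coeff_map_poly coeff_mult to_ac_sum)

lemma map_poly_to_ac_add:
  "map_poly to_ac (f + g) = map_poly to_ac f + map_poly to_ac g"
  by (rule poly_eqI) (simp add: coeff_map_poly)

lemma map_poly_to_ac_diff:
  "map_poly to_ac (f - g) = map_poly to_ac f - map_poly to_ac g"
  by (rule poly_eqI) (simp add: coeff_map_poly)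

text \<open>
  This is the minimality of the degree of an irreducible polynomial among all polynomials with a
  given root. In the Euclidean algorithm the remainder \<open>f mod g\<close> inherits the root \<open>a\<close>, so the
  degree of \<open>g\<close> can be lowered until \<open>g\<close> divides \<open>f\<close>, and then \<open>g\<close> is an associate of \<open>f\<close>.
\<close>
lemma irreducible_degree_le:
  fixes f g :: "'a :: field poly"
  assumes irred: "Factorial_Ring.irreducible f"
    and f: "poly (map_poly to_ac f) a = 0"
    and g: "poly (map_poly to_ac g) a = 0" "g \<noteq> 0"
  shows "Polynomial.degree f \<le> Polynomial.degree g"
  using g
proof (induction "Polynomial.degree g" arbitrary: g rule: less_induct)
  case less
  let ?r = "f mod g"
  have "f = f div g * g + ?r" by simp
  then have "map_poly to_ac f = map_poly to_ac (f div g) * map_poly to_ac g + map_poly to_ac ?r"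
    by (metis map_poly_to_ac_add map_poly_to_ac_mult)
  then have r: "poly (map_poly to_ac ?r) a = 0"
    using f less.prems by simp
  show ?case
  proof (cases "?r = 0")
    case False
    then show ?thesis
      using less.hyps[of ?r] r degree_mod_less'[of g f] less.prems by force
  next
    case True
    then obtain h where h: "f = g * h" by auto
    have "Polynomial.degree g \<noteq> 0"
    proof
      assume "Polynomial.degree g = 0"
      then obtain c where "g = [:c:]" by (rule degree_eq_zeroE)
      then show False using less.prems by (simp add: map_poly_pCons)
    qed
    then have "\<not> g dvd 1"
      using less.prems by (auto dest: dvd_imp_degree_le)
    then have "h dvd 1" using irreducibleD[OF irred h] by blast
    then have "Polynomial.degree h = 0"
      using divides_degree[of h 1] by simp
    then show ?thesis unfolding h using degree_mult_le[of g h] by simp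
  qed
qed

text \<open>
  The condition on \<open>a\<close> says that the Frobenius map exchanges (or fixes) \<open>a\<close> and \<open>a\<^sup>q\<close>, hence fixes
  their sum and product, which are the coefficients of a rational quadratic polynomial vanishing
  at \<open>a\<close>.
\<close>
lemma irreducible_degree_le_2:
  fixes f :: "'a :: {field, finite} poly"
  assumes irred: "Factorial_Ring.irreducible f"
    and root: "poly (map_poly to_ac f) a = 0"
    and frob: "(a ^ CARD('a)) ^ CARD('a) = a"
  shows "Polynomial.degree f \<le> 2"
proof -
  let ?b = "a ^ CARD('a)"
  have "(a + ?b) ^ CARD('a) = a + ?b" "(a * ?b) ^ CARD('a) = a * ?b"
    by (simp_all only: power_card_add power_mult_distrib frob add.commute mult.commute)
  then obtain s p :: 'a where sp: "a + ?b = to_ac s" "a * ?b = to_ac p"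
    using power_card_fixed_imp_rational[of "a + ?b"] power_card_fixed_imp_rational[of "a * ?b"]
    by blast
  let ?g = "[:p, - s, 1:]"
  have "poly (map_poly to_ac ?g) a = 0"
    using sp by (simp add: map_poly_pCons algebra_simps flip: sp)
  then have "Polynomial.degree f \<le> Polynomial.degree ?g"
    by (intro irreducible_degree_le[OF irred root]) auto
  then show ?thesis by simp
qed

lemma reducible_cubic_has_root:
  fixes f :: "'a :: field poly"
  assumes deg: "Polynomial.degree f = 3" and red: "\<not> Factorial_Ring.irreducible f"
  obtains c where "poly f c = 0"
proof -
  have "f \<noteq> 0" using deg by auto
  moreover have "\<not> f dvd 1"
    using dvd_imp_degree_le[of f 1] deg by auto
  ultimately obtain g h where gh: "f = g * h" "\<not> g dvd 1" "\<not> h dvd 1"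
    using red irreducibleI[of f] by blast
  have nz: "g \<noteq> 0" "h \<noteq> 0" using gh \<open>f \<noteq> 0\<close> by auto
  have "Polynomial.degree g \<noteq> 0" "Polynomial.degree h \<noteq> 0"
    using gh nz by (auto simp: is_unit_iff_degree)
  moreover have "Polynomial.degree g + Polynomial.degree h = 3"
    using gh nz deg by (simp add: degree_mult_eq)
  ultimately have "Polynomial.degree g = 1 \<or> Polynomial.degree h = 1" by linarith
  moreover have "\<exists>c. poly l c = 0" if deg_l: "Polynomial.degree l = 1" for l :: "'a poly"
  proof -
    obtain v u where "l = [:u, v:]" "v \<noteq> 0"
      using deg_l by (rule degree1_coeffs)
    then show ?thesis by (intro exI[of _ "- u / v"]) simp
  qed
  ultimately show ?thesis using gh(1) that by auto
qed

section \<open>The characteristic polynomial\<close>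

lemma degree_charpoly_3:
  fixes A :: "'a :: field ^ 3 ^ 3"
  shows "Polynomial.degree (charpoly A) = 3"
  by (simp add: charpoly_def det_3 mat_def)

lemma poly_charpoly:
  fixes A :: "'a :: field ^ 3 ^ 3"
  shows "poly (charpoly A) c = det (mat c - A)"
  by (simp add: charpoly_def det_3 mat_def algebra_simps)

lemma poly_map_charpoly:
  fixes A :: "'a :: field ^ 3 ^ 3"
  shows "poly (map_poly to_ac (charpoly A)) a = det (mat a - map_matrix to_ac A)"
  by (simp add: charpoly_def det_3 mat_def map_poly_to_ac_mult map_poly_to_ac_add
      map_poly_to_ac_diff map_poly_pCons algebra_simps)

lemma det_eq_0_iff_right_eigenvector:
  fixes M :: "'k :: field ^ 'n ^ 'n"
  shows "det (mat a - M) = 0 \<longleftrightarrow> (\<exists>v. v \<noteq> 0 \<and> M *v v = a *s v)"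
proof -
  have "mat a *v v = a *s v" for v :: "'k ^ 'n"
    by (simp add: vec_eq_iff matrix_vector_mult_def mat_def if_distrib if_distribR cong: if_cong)
  then have "(mat a - M) *v v = 0 \<longleftrightarrow> M *v v = a *s v" for v
    by (auto simp: matrix_vector_mult_diff_rdistrib)
  then show ?thesis
    using invertible_det_nz[of "mat a - M"] matrix_left_invertible_ker[of "mat a - M"]
    by (auto simp: invertible_left_inverse)
qed

lemma det_eq_0_iff_left_eigenvector:
  fixes M :: "'k :: field ^ 'n ^ 'n"
  shows "det (mat a - M) = 0 \<longleftrightarrow> (\<exists>v. v \<noteq> 0 \<and> v v* M = a *s v)"
proof -
  have "mat a - transpose M = transpose (mat a - M)"
    by (simp add: vec_eq_iff transpose_def mat_def)
  then have "det (mat a - transpose M) = det (mat a - M)"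
    by (metis det_transpose)
  then show ?thesis
    using det_eq_0_iff_right_eigenvector[of a "transpose M"] by simp
qed

section \<open>The cross product over a field\<close>

text \<open>
  Over a general field a nonzero vector may be orthogonal to itself, so a nonzero vector \<open>v\<close> is not normalised by \<open>v \<cdot> v\<close> but by some \<open>e\<close> with \<open>e \<cdot> v = 1\<close>. The lemmas on
  parallel and coplanar vectors below come from polynomial identities evaluated at such an \<open>e\<close>.
\<close>

definition vcross :: "'k :: comm_ring ^ 3 \<Rightarrow> 'k ^ 3 \<Rightarrow> 'k ^ 3" where
  "vcross u v = vector [u$2 * v$3 - u$3 * v$2, u$3 * v$1 - u$1 * v$3, u$1 * v$2 - u$2 * v$1]"

lemma vcross_component:
  "vcross u v $ 1 = u$2 * v$3 - u$3 * v$2"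
  "vcross u v $ 2 = u$3 * v$1 - u$1 * v$3"
  "vcross u v $ 3 = u$1 * v$2 - u$2 * v$1"
  by (simp_all add: vcross_def)

lemma scalar_product_add_right: "scalar_product u (v + w) = scalar_product u v + scalar_product u w"
  by (simp add: scalar_product_def distrib_left sum.distrib)

lemma scalar_product_scale_right:
  "scalar_product u (c *s v) = (c :: 'k :: comm_ring_1) * scalar_product u v"
  by (simp add: scalar_product_def sum_distrib_left mult_ac)

lemma scalar_product_commute:
  "scalar_product u v = scalar_product v (u :: 'k :: comm_ring_1 ^ 'n)"
  by (simp add: scalar_product_def mult.commute)

lemma scalar_product_0_right [simp]: "scalar_product u 0 = 0"
  by (simp add: scalar_product_def)

lemma scalar_product_matrix:
  fixes M :: "'k :: comm_ring_1 ^ 'n ^ 'n"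
  shows "scalar_product (u v* M) v = scalar_product u (M *v v)"
  unfolding scalar_product_def vector_matrix_mult_def matrix_vector_mult_def
  by (simp add: sum_distrib_left sum_distrib_right mult_ac) (rule sum.swap)

lemma scalar_product_vcross_self:
  fixes u v :: "'k :: comm_ring_1 ^ 3"
  shows "scalar_product u (vcross u v) = 0" "scalar_product v (vcross u v) = 0"
  by (simp_all add: scalar_product_def sum_3 vcross_component algebra_simps)

lemma nonzero_imp_scalar_product_1:
  fixes v :: "'k :: field ^ 'n"
  assumes "v \<noteq> 0"
  obtains e where "scalar_product e v = 1"
proof -
  obtain i where i: "v $ i \<noteq> 0" using assms by (auto simp: vec_eq_iff)
  have "scalar_product (axis i (1 / v $ i)) v = (\<Sum>j\<in>UNIV. if j = i then v $ j / v $ i else 0)"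
    unfolding scalar_product_def by (intro sum.cong) (auto simp: axis_def)
  then show ?thesis using i that[of "axis i (1 / v $ i)"] by simp
qed

lemma vcross_eq_0_imp_parallel:
  fixes u v :: "'k :: field ^ 3"
  assumes "v \<noteq> 0" "vcross v u = 0"
  obtains c where "u = c *s v"
proof -
  obtain e where e: "scalar_product e v = 1" using assms(1) by (rule nonzero_imp_scalar_product_1)
  \<comment> \<open>the triple product expansion\<close>
  have "vcross e (vcross v u) = scalar_product e u *s v - scalar_product e v *s u"
    by (simp add: vec_eq_iff forall_3 vcross_component scalar_product_def sum_3 algebra_simps)
  moreover have "vcross e (vcross v u) = 0"
    using assms(2) by (simp add: vec_eq_iff forall_3 vcross_component)
  ultimately show ?thesis using e that[of "scalar_product e u"] by simp
qed

lemma orthogonal_vcross_imp_combination: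
  fixes u v1 v2 :: "'k :: field ^ 3"
  assumes "vcross v1 v2 \<noteq> 0" "scalar_product u (vcross v1 v2) = 0"
  obtains a b where "u = a *s v1 + b *s v2"
proof -
  obtain e where e: "scalar_product e (vcross v1 v2) = 1"
    using assms(1) by (rule nonzero_imp_scalar_product_1)
  \<comment> \<open>Cramer's rule for \<open>u\<close> in terms of \<open>v1\<close>, \<open>v2\<close>, \<open>e\<close>; the last coefficient vanishes by assumption\<close>
  have "scalar_product e (vcross v1 v2) *s u =
      scalar_product e (vcross u v2) *s v1 + scalar_product e (vcross v1 u) *s v2
      + scalar_product u (vcross v1 v2) *s e"
    by (simp add: vec_eq_iff forall_3 vcross_component scalar_product_def sum_3 algebra_simps)
  then show ?thesis
    using e assms(2) that[of "scalar_product e (vcross u v2)" "scalar_product e (vcross v1 u)"]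
    by simp
qed

text \<open>The orthogonal space of two independent vectors is the line spanned by their cross product.\<close>
lemma common_orthogonal_imp_vcross_0:
  fixes u v n n' :: "'k :: field ^ 3"
  assumes nz: "vcross n n' \<noteq> 0"
    and u: "scalar_product u n = 0" "scalar_product u n' = 0"
    and v: "scalar_product v n = 0" "scalar_product v n' = 0"
  shows "vcross u v = 0"
proof -
  have "\<exists>c. x = c *s vcross n n'" if "scalar_product x n = 0" "scalar_product x n' = 0" for x
  proof -
    have "vcross (vcross n n') x = scalar_product x n *s n' - scalar_product x n' *s n"
      by (simp add: vec_eq_iff forall_3 vcross_component scalar_product_def sum_3 algebra_simps)
    then have "vcross (vcross n n') x = 0" using that by simp
    then show ?thesis using vcross_eq_0_imp_parallel[OF nz] by blast
  qed
  then obtain c d where "u = c *s vcross n n'" "v = d *s vcross n n'"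
    using u v by meson
  then show ?thesis by (simp add: vec_eq_iff forall_3 vcross_component)
qed

section \<open>Singular points and eigenvalues\<close>

definition frob :: "nat \<Rightarrow> 'k :: field ^ 'n \<Rightarrow> 'k ^ 'n" where
  "frob q v = (\<chi> i. (v $ i) ^ q)"

text \<open>
  The assumptions \<open>vanish\<close> and \<open>grad\<close> say that \<open>P\<close> is a singular point; as the
  \<open>q\<close>-th power map is additive and fixes the entries of \<open>M\<close>, its coordinatewise extension commutes
  with cross products and with \<open>M\<close>. The conclusion is that \<open>M\<close> has an eigenvalue fixed by
  the square of the Frobenius map.
\<close>
lemma singular_imp_eigenvalue:
  fixes M :: "'k :: field ^ 3 ^ 3" and P :: "'k ^ 3" and q :: nat
  defines "w \<equiv> vcross (frob q P) P"
  assumes q: "q > 0"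
    and additive: "\<And>x y :: 'k. (x + y) ^ q = x ^ q + y ^ q"
    and M: "\<And>i j. (M $ i $ j) ^ q = M $ i $ j"
    and P: "P \<noteq> 0"
    and vanish: "scalar_product P (M *v w) = 0"
    and grad: "M *v w + vcross (P v* M) (frob q P) = 0"
  obtains a where "det (mat a - M) = 0" "(a ^ q) ^ q = a"
proof -
  define f where "f = (frob q :: 'k ^ 3 \<Rightarrow> 'k ^ 3)"
  have f: "f v $ i = (v $ i) ^ q" for v i
    by (simp add: f_def frob_def)
  have sub: "(x - y) ^ q = x ^ q - y ^ q" for x y :: 'k
    using additive[of "x - y" y] by simp
  have f_scale: "f (c *s v) = c ^ q *s f v" for c v
    by (simp add: vec_eq_iff f power_mult_distrib)
  have f_add: "f (u + v) = f u + f v" for u v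
    by (simp add: vec_eq_iff f additive)
  have f_vcross: "f (vcross u v) = vcross (f u) (f v)" for u v
    by (simp add: vec_eq_iff forall_3 f vcross_component sub power_mult_distrib)
  have f_left: "f (v v* M) = f v v* M" for v
    by (simp add: vec_eq_iff f vector_matrix_mult_def sum_3 additive power_mult_distrib M)
  have f_right: "f (M *v v) = M *v f v" for v
    by (simp add: vec_eq_iff f matrix_vector_mult_def sum_3 additive power_mult_distrib M)
  have f_eq_0: "f v = 0 \<longleftrightarrow> v = 0" for v
    using q by (simp add: vec_eq_iff f)
  have w: "w = vcross (f P) P"
    by (simp add: w_def f_def)
  note grad = grad[folded f_def]
  show ?thesis
  proof (cases "w = 0")
    case True
    \<comment> \<open>\<open>P\<close> represents a rational point, which is then a rational left eigenvector.\<close>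
    have "vcross P (f P) = 0"
      using True by (simp add: w vec_eq_iff forall_3 vcross_component algebra_simps)
    then obtain c where c: "f P = c *s P"
      using vcross_eq_0_imp_parallel[OF P] by metis
    have "c \<noteq> 0" using c P f_eq_0[of P] by auto
    then have "vcross P (P v* M) = 0"
      using grad unfolding c True
      by (auto simp: vec_eq_iff forall_3 vcross_component algebra_simps)
    then obtain a where a: "P v* M = a *s P"
      using vcross_eq_0_imp_parallel[OF P] by metis
    have "f (P v* M) = c *s (P v* M)"
      unfolding f_left c
      by (simp add: vec_eq_iff vector_matrix_mult_def sum_distrib_left mult.assoc)
    also have "\<dots> = (c * a) *s P"
      by (simp only: a vector_smult_assoc)
    finally have "f (P v* M) = (c * a) *s P" .
    moreover have "f (P v* M) = (c * a ^ q) *s P"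
      unfolding a f_scale c by (simp add: mult.commute)
    ultimately have "a ^ q = a" using P \<open>c \<noteq> 0\<close> by simp
    then show ?thesis using that[of a] det_eq_0_iff_left_eigenvector[of a M] a P by auto
  next
    case False
    have "scalar_product (P v* M) w = 0"
      using vanish by (simp add: scalar_product_matrix)
    then obtain b a where PM: "P v* M = b *s f P + a *s P"
      using orthogonal_vcross_imp_combination[of "f P" P "P v* M"] False unfolding w by metis
    have Mw: "M *v w = a *s w"
      using grad unfolding PM w
      by (simp add: vec_eq_iff forall_3 vcross_component algebra_simps)
    have Mfw: "M *v f w = a ^ q *s f w"
      using arg_cong[OF Mw, of f] by (simp only: f_right f_scale)
    have fw: "f w = vcross (f (f P)) (f P)"
      by (simp only: w f_vcross)
    \<comment> \<open>\<open>w\<close> is orthogonal to \<open>P\<close> and \<open>f P\<close>, hence \<open>f w\<close> to \<open>f P\<close> and \<open>f (f P)\<close>.\<close>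
    have orth: "scalar_product (f P) w = 0" "scalar_product (f P) (f w) = 0"
      "scalar_product (f (f P)) (f w) = 0"
      by (simp_all only: fw) (simp_all only: w scalar_product_vcross_self)
    have "(a ^ q) ^ q = a"
    proof (cases "vcross w (f w) = 0")
      case True
      then obtain c where c: "f w = c *s w"
        using vcross_eq_0_imp_parallel[OF False] by metis
      have "c \<noteq> 0" using c False f_eq_0[of w] by auto
      have "(c * a) *s w = (a ^ q * c) *s w"
        using Mfw unfolding c by (simp add: matrix_vector_mult_scaleR Mw vector_scalar_commute)
      then have "a ^ q = a" using False \<open>c \<noteq> 0\<close> by simp
      then show ?thesis by simp
    next
      case indep: False
      \<comment> \<open>Otherwise \<open>f P\<close> and \<open>f (f P)\<close> would both be orthogonal to \<open>w\<close> and \<open>f w\<close>, hence parallel.\<close>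
      have d: "scalar_product (f (f P)) w \<noteq> 0"
      proof
        assume "scalar_product (f (f P)) w = 0"
        then have "vcross (f (f P)) (f P) = 0"
          using common_orthogonal_imp_vcross_0[OF indep _ orth(3) orth(1,2)] by blast
        then have "f w = 0" by (simp only: fw)
        then show False using False f_eq_0 by simp
      qed
      have eigen: "scalar_product (v v* M) w = a * scalar_product v w" for v
        by (simp add: scalar_product_matrix Mw scalar_product_scale_right)
      \<comment> \<open>Pairing the image of the relation \<open>PM\<close> under \<open>f\<close> with \<open>w\<close> leaves only the term with \<open>b\<close>.\<close>
      have "f P v* M = b ^ q *s f (f P) + a ^ q *s f P"
        by (simp only: PM f_add f_scale flip: f_left)
      then have "b ^ q * scalar_product (f (f P)) w = 0"
        using eigen[of "f P"] orth
        by (simp add: scalar_product_commute[of _ w] scalar_product_add_right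
            scalar_product_scale_right)
      then have "P v* M = a *s P" using d PM by simp
      then have "f (f P) v* M = (a ^ q) ^ q *s f (f P)"
        by (simp only: f_scale flip: f_left)
      then show ?thesis
        using eigen[of "f (f P)"] d
        by (simp add: scalar_product_commute[of _ w] scalar_product_scale_right)
    qed
    moreover have "det (mat a - M) = 0"
      using det_eq_0_iff_right_eigenvector[of a M] Mw False by blast
    ultimately show ?thesis using that by blast
  qed
qed

lemma eval3_ac_curve_form:
  "eval3_ac (curve_form q A) P =
     scalar_product P (map_matrix to_ac A *v vcross (frob q P) P)"
  by (simp add: curve_form_def Let_def scalar_product_def matrix_vector_mult_def sum_3
      eval3_ac_simps vcross_component frob_def algebra_simps)

lemma eval3_ac_pderiv3_curve_form:
  fixes A :: "'a :: field ^ 3 ^ 3"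
  assumes q: "of_nat q = (0 :: 'a)"
  shows "eval3_ac (pderiv3 i (curve_form q A)) P =
     (map_matrix to_ac A *v vcross (frob q P) P + vcross (P v* map_matrix to_ac A) (frob q P)) $ i"
proof -
  have "of_nat q = (0 :: 'a poly3)"
    using q by (simp flip: single_of_nat)
  then have "pderiv3 i (F ^ q) = 0" for F :: "'a poly3"
    by (simp add: pderiv3_power)
  then show ?thesis
    using exhaust_3[of i]
    by (elim disjE; simp add: curve_form_def Let_def scalar_product_def matrix_vector_mult_def
      vector_matrix_mult_def sum_3 pderiv3_add pderiv3_diff pderiv3_mult pderiv3_Const3 pderiv3_Var3
      eval3_ac_simps vcross_component frob_def)
      (simp_all add: algebra_simps)
qed

theorem theorem3p2:
  fixes A :: "'a :: {field, finite} ^ 3 ^ 3" and q :: nat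
  assumes "q = CARD('a)"
  shows "nonsingular_curve (curve_form q A) \<longleftrightarrow> Factorial_Ring.irreducible (charpoly A)"
proof -
  define M where "M = map_matrix to_ac A"
  have "of_nat q = (0 :: 'a)"
    using of_nat_card_eq_0 assms by simp
  then have singular: "\<not> nonsingular_curve (curve_form q A) \<longleftrightarrow>
      (\<exists>P. P \<noteq> 0 \<and> scalar_product P (M *v vcross (frob q P) P) = 0 \<and>
        M *v vcross (frob q P) P + vcross (P v* M) (frob q P) = 0)"
    unfolding nonsingular_curve_def M_def
    by (auto simp: eval3_ac_curve_form eval3_ac_pderiv3_curve_form forall_3
        vec_eq_iff[of "_ + _" 0])
  show ?thesis
  proof
    assume nonsing: "nonsingular_curve (curve_form q A)"
    show "Factorial_Ring.irreducible (charpoly A)"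
    proof (rule ccontr)
      assume "\<not> Factorial_Ring.irreducible (charpoly A)"
      then obtain c where "poly (charpoly A) c = 0"
        using reducible_cubic_has_root[OF degree_charpoly_3] by blast
      then obtain v where v: "v \<noteq> 0" "v v* A = c *s v"
        using det_eq_0_iff_left_eigenvector[of c A] by (auto simp: poly_charpoly)
      define P where "P = (\<chi> i. to_ac (v $ i))"
      have "P \<noteq> 0" using v(1) by (auto simp: P_def vec_eq_iff)
      have frob: "frob q P = P"
        by (simp add: P_def frob_def vec_eq_iff assms power_card_eq_self flip: to_ac_power)
      have "(P v* M) $ i = to_ac ((v v* A) $ i)" for i
        by (simp add: P_def M_def vector_matrix_mult_def to_ac_sum)
      then have PM: "P v* M = to_ac c *s P"
        by (simp add: v(2) vec_eq_iff P_def)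
      have "vcross P P = 0" "vcross (P v* M) P = 0"
        by (simp_all add: PM vec_eq_iff forall_3 vcross_component)
      then have "scalar_product P (M *v vcross (frob q P) P) = 0"
        "M *v vcross (frob q P) P + vcross (P v* M) (frob q P) = 0"
        by (simp_all add: frob)
      then have "\<not> nonsingular_curve (curve_form q A)"
        unfolding singular using \<open>P \<noteq> 0\<close> by (intro exI[of _ P] conjI)
      then show False using nonsing by contradiction
    qed
  next
    assume irred: "Factorial_Ring.irreducible (charpoly A)"
    show "nonsingular_curve (curve_form q A)"
    proof (rule ccontr)
      assume "\<not> nonsingular_curve (curve_form q A)"
      then obtain P where "P \<noteq> 0" "scalar_product P (M *v vcross (frob q P) P) = 0"
        "M *v vcross (frob q P) P + vcross (P v* M) (frob q P) = 0"
        using singular by blast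
      moreover have "(M $ i $ j) ^ q = M $ i $ j" for i j
        by (simp add: M_def assms power_card_eq_self flip: to_ac_power)
      ultimately obtain a where a: "det (mat a - M) = 0" "(a ^ q) ^ q = a"
        using singular_imp_eigenvalue[of q M P] power_card_add assms by auto
      have "Polynomial.degree (charpoly A) \<le> 2"
        using irreducible_degree_le_2[OF irred, of a] a
        by (simp add: poly_map_charpoly M_def assms)
      then show False by (simp add: degree_charpoly_3)
    qed
  qed
qed

end
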